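(* Let $G$ be a finite simple graph of order $n\geq 2$, and let $\overline{G}$ denote its complement. If $G$ is not isomorphic to the $5$-cycle $C_5$, then $\gamma_{\rm ri2}(G)+\gamma_{\rm ri2}(\overline{G})\leq n+2$.
   Context: For a positive integer $k$, a $k$-rainbow independent dominating function ($k$RiDF) of a graph $G$ is a function $f: V(G)\to\{0,1,\ldots,k\}$ such that, writing $V_i=\{v: f(v)=i\}$, for every $i\in\{1,\ldots,k\}$ the set $V_i$ is an independent set of $G$ and every vertex $v$ with $f(v)=0$ is adjacent to some vertex $u$ with $f(u)=i$. The weight of $f$ is the number of vertices $v$ with $f(v)\neq 0$. The $k$-rainbow independent domination number $\gamma_{\rm rik}(G)$ is the minimum weight of a $k$RiDF of $G$; in particular $\gamma_{\rm ri2}(G)$ is this quantity for $k=2$. The order of $G$ is $|V(G)|$. *)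

theory Defs
  imports "Graph_Theory.Graph_Theory"
begin

text \<open>
  A finite simple graph is a \<^locale>\<open>pair_graph\<close>: a finite vertex set with a symmetric, irreflexive
  adjacency relation \<^const>\<open>parcs\<close> on it, each edge being represented by its two opposite arcs.
\<close>

definition graph_complement :: "'a pair_pre_digraph \<Rightarrow> 'a pair_pre_digraph" where
  "graph_complement G = \<lparr> pverts = pverts G,
     parcs = {(u, v). u \<in> pverts G \<and> v \<in> pverts G \<and> u \<noteq> v \<and> (u, v) \<notin> parcs G} \<rparr>"

text \<open>This is the \<open>n\<close>-cycle for \<open>n \<ge> 3\<close>.\<close>

definition cycle_graph :: "nat \<Rightarrow> nat pair_pre_digraph" where
  "cycle_graph n = \<lparr> pverts = {0..<n},
     parcs = {(i, j). i < n \<and> j < n \<and> (j = (i + 1) mod n \<or> i = (j + 1) mod n)} \<rparr>"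

definition independent_set :: "'a pair_pre_digraph \<Rightarrow> 'a set \<Rightarrow> bool" where
  "independent_set G A \<longleftrightarrow> A \<subseteq> pverts G \<and> (\<forall>u\<in>A. \<forall>v\<in>A. (u, v) \<notin> parcs G)"

text \<open>Only the values of \<open>f\<close> on the vertices of \<open>G\<close> matter.\<close>

definition kRiDF :: "nat \<Rightarrow> 'a pair_pre_digraph \<Rightarrow> ('a \<Rightarrow> nat) \<Rightarrow> bool" where
  "kRiDF k G f \<longleftrightarrow>
     f ` pverts G \<subseteq> {0..k} \<and>
     (\<forall>i\<in>{1..k}.
        independent_set G {v \<in> pverts G. f v = i} \<and>
        (\<forall>v\<in>pverts G. f v = 0 \<longrightarrow> (\<exists>u\<in>pverts G. (v, u) \<in> parcs G \<and> f u = i)))"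

definition weight :: "'a pair_pre_digraph \<Rightarrow> ('a \<Rightarrow> nat) \<Rightarrow> nat" where
  "weight G f = card {v \<in> pverts G. f v \<noteq> 0}"

text \<open>
  Every finite simple graph has a kRiDF: repeatedly colour a maximal independent set of the
  vertices not coloured so far. So the minimum below is attained.
\<close>

definition gamma_ri :: "nat \<Rightarrow> 'a pair_pre_digraph \<Rightarrow> nat" where
  "gamma_ri k G = (LEAST w. \<exists>f. kRiDF k G f \<and> weight G f = w)"

end

theory Submission
  imports Defs
begin

text \<open>
  A 2RiDF of the graph has two independent colour classes and a 2RiDF of the complement has two
  cliques as colour classes, so their supports share at most four vertices and the two weights
  always add up to at most \<open>n + 4\<close>. Any partial colouring extends greedily to a 2RiDF, so seeds can
  force chosen vertices to get colour 0. If two vertices can be forced to get colour 0 in both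
  graphs, the bound drops to \<open>n + 2\<close>. If the graph has a simplicial vertex \<open>a\<close>, then in the
  complement \<open>{a}\<close> together with a maximal clique containing the neighbours of \<open>a\<close> is the support
  of a 2RiDF; this gives \<open>n + 2\<close> unless all vertices outside the clique have degree at most 1, and
  then suitable 2RiDFs are explicit.

  In a counterexample, neither the graph nor its complement has a simplicial vertex, so by Dirac's
  theorem both contain induced cycles of length at least 4. Holes of length at least 6 contain two
  vertices that can be forced to get colour 0 in both graphs. An induced 5-cycle must be the whole
  graph, and an induced 4-cycle cannot coexist with an induced \<open>2K\<^sub>2\<close>, the complement of a 4-cycle.
\<close>

section \<open>Rainbow pairs\<close>

text \<open>\<open>I\<close> and \<open>J\<close> stand for the colour classes \<open>V_1\<close>
  and \<open>V_2\<close> of a 2RiDF; its weight is \<open>card (I \<union> J)\<close>.\<close>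

definition rainbow_pair :: "'a set \<Rightarrow> ('a \<Rightarrow> 'a \<Rightarrow> bool) \<Rightarrow> 'a set \<Rightarrow> 'a set \<Rightarrow> bool" where
  "rainbow_pair V E I J \<longleftrightarrow> I \<subseteq> V \<and> J \<subseteq> V \<and> I \<inter> J = {} \<and>
     (\<forall>u\<in>I. \<forall>v\<in>I. \<not> E u v) \<and> (\<forall>u\<in>J. \<forall>v\<in>J. \<not> E u v) \<and>
     (\<forall>v\<in>V - (I \<union> J). (\<exists>u\<in>I. E v u) \<and> (\<exists>u\<in>J. E v u))"

text \<open>Complement adjacency. Confining it to \<open>V\<close> makes it an involution on graphs
  (\<open>co_co\<close>), so every result can also be read in the complement.\<close>

definition co :: "'a set \<Rightarrow> ('a \<Rightarrow> 'a \<Rightarrow> bool) \<Rightarrow> 'a \<Rightarrow> 'a \<Rightarrow> bool" where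
  "co V E u v \<longleftrightarrow> u \<in> V \<and> v \<in> V \<and> u \<noteq> v \<and> \<not> E u v"

text \<open>Explicit witnesses in place of the two minima make the bound visibly symmetric under
  complementation (\<open>good_co\<close>).\<close>

definition good :: "'a set \<Rightarrow> ('a \<Rightarrow> 'a \<Rightarrow> bool) \<Rightarrow> bool" where
  "good V E \<longleftrightarrow> (\<exists>I J A B. rainbow_pair V E I J \<and> rainbow_pair V (co V E) A B \<and>
     card (I \<union> J) + card (A \<union> B) \<le> card V + 2)"

locale sgraph =
  fixes V :: "'a set" and E :: "'a \<Rightarrow> 'a \<Rightarrow> bool"
  assumes finite_V: "finite V"
    and E_sym: "E u v \<Longrightarrow> E v u"
    and E_irrefl: "\<not> E u u"
    and E_V: "E u v \<Longrightarrow> u \<in> V \<and> v \<in> V"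
begin

lemma E_commute: "E u v \<longleftrightarrow> E v u"
  using E_sym by blast

lemma co_co: "co V (co V E) = E"
  using E_V E_irrefl by (auto simp: co_def fun_eq_iff)

lemma sgraph_co: "sgraph V (co V E)"
  using finite_V by unfold_locales (auto simp: co_def dest: E_sym)

lemma good_co: "good V (co V E) \<longleftrightarrow> good V E"
  unfolding good_def co_co by (metis add.commute)

text \<open>Colour greedily the vertices outside \<open>Z\<close>, starting from the given seeds.\<close>

lemma rainbow_extend:
  assumes "I0 \<subseteq> V" "J0 \<subseteq> V" "I0 \<inter> J0 = {}" "Z \<inter> (I0 \<union> J0) = {}"
    and "\<forall>u\<in>I0. \<forall>v\<in>I0. \<not> E u v" "\<forall>u\<in>J0. \<forall>v\<in>J0. \<not> E u v"
    and "\<forall>z\<in>Z. (\<exists>u\<in>I0. E z u) \<and> (\<exists>u\<in>J0. E z u)"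
  obtains I J where "rainbow_pair V E I J" "I0 \<subseteq> I" "J0 \<subseteq> J" "Z \<inter> (I \<union> J) = {}"
proof -
  \<comment> \<open>\<open>P\<close> describes the partial colourings that extend the seeds and
    avoid \<open>Z\<close>; one with the largest support turns out to be a 2RiDF.\<close>
  define P where "P I J \<longleftrightarrow> I0 \<subseteq> I \<and> J0 \<subseteq> J \<and> I \<subseteq> V \<and> J \<subseteq> V \<and> I \<inter> J = {} \<and>
     (\<forall>u\<in>I. \<forall>v\<in>I. \<not> E u v) \<and> (\<forall>u\<in>J. \<forall>v\<in>J. \<not> E u v) \<and> Z \<inter> (I \<union> J) = {}" for I J
  have "P I0 J0"
    using assms by (auto simp: P_def)
  moreover have "\<forall>X. P (fst X) (snd X) \<longrightarrow> card (fst X \<union> snd X) < Suc (card V)"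
    using finite_V by (auto simp: P_def less_Suc_eq_le intro!: card_mono)
  ultimately obtain X where X: "P (fst X) (snd X)"
      "\<forall>Y. P (fst Y) (snd Y) \<longrightarrow> card (fst Y \<union> snd Y) \<le> card (fst X \<union> snd X)"
    using ex_has_greatest_nat[of "\<lambda>X. P (fst X) (snd X)" "(I0, J0)" "\<lambda>X. card (fst X \<union> snd X)" "Suc (card V)"]
    by auto
  define I J where "I = fst X" and "J = snd X"
  have P: "P I J" and max: "\<And>I' J'. P I' J' \<Longrightarrow> card (I' \<union> J') \<le> card (I \<union> J)"
    using X by (auto simp: I_def J_def)
  have fin: "finite (I \<union> J)"
    using P finite_V by (auto simp: P_def intro: finite_subset)
  \<comment> \<open>Vertices of \<open>Z\<close> see both colours through the seeds. Any other
    uncoloured vertex that misses a colour among its neighbours could receive that colour, against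
    maximality.\<close>
  have "(\<exists>u\<in>I. E v u) \<and> (\<exists>u\<in>J. E v u)" if v: "v \<in> V" "v \<notin> I \<union> J" for v
  proof (cases "v \<in> Z")
    case True
    then obtain u w where "u \<in> I0" "E v u" "w \<in> J0" "E v w"
      using assms(7) by blast
    moreover have "I0 \<subseteq> I" "J0 \<subseteq> J"
      using P by (auto simp: P_def)
    ultimately show ?thesis
      by blast
  next
    case False
    have "card (insert v (I \<union> J)) > card (I \<union> J)"
      using v fin by simp
    then have no: "\<not> P (insert v I) J" "\<not> P I (insert v J)"
      using max[of "insert v I" J] max[of I "insert v J"] by auto
    have sym: "\<And>u. \<not> E v u \<Longrightarrow> \<not> E u v"
      using E_sym by blast
    have "\<exists>u\<in>I. E v u"
    proof (rule ccontr)
      assume "\<not> ?thesis"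
      then have "P (insert v I) J"
        using P v False E_irrefl sym by (auto simp: P_def)
      then show False
        using no by simp
    qed
    moreover have "\<exists>u\<in>J. E v u"
    proof (rule ccontr)
      assume "\<not> ?thesis"
      then have "P I (insert v J)"
        using P v False E_irrefl sym by (auto simp: P_def)
      then show False
        using no by simp
    qed
    ultimately show ?thesis
      by blast
  qed
  then have "rainbow_pair V E I J"
    using P by (auto simp: rainbow_pair_def P_def)
  then show thesis
    using that P by (auto simp: P_def)
qed

lemma rainbow_exists: obtains I J where "rainbow_pair V E I J"
  using rainbow_extend[of "{}" "{}" "{}"] by auto

lemma rainbow_seed:
  assumes "E z u" "E z w" "u \<noteq> w"
  obtains I J where "rainbow_pair V E I J" "z \<notin> I \<union> J"
proof (rule rainbow_extend[of "{u}" "{w}" "{z}"])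
qed (use assms E_V E_irrefl in auto)

text \<open>The seeds \<open>{u, u'}\<close> and \<open>{w, w'}\<close> each contain a neighbour of
  \<open>z\<close> and one of \<open>z'\<close>. The cases \<open>u = u'\<close> and
  \<open>w = w'\<close> are allowed and are used often.\<close>

lemma rainbow_null_pair:
  assumes "E z u" "E z w" "E z' u'" "E z' w'"
    and "u \<noteq> z'" "w \<noteq> z'" "u' \<noteq> z" "w' \<noteq> z" "u \<noteq> w" "u' \<noteq> w'" "u \<noteq> w'" "w \<noteq> u'"
    and "\<not> E u u'" "\<not> E w w'"
  obtains I J where "rainbow_pair V E I J" "z \<notin> I \<union> J" "z' \<notin> I \<union> J"
proof -
  have V: "u \<in> V" "w \<in> V" "u' \<in> V" "w' \<in> V"
    and ne: "u \<noteq> z" "w \<noteq> z" "u' \<noteq> z'" "w' \<noteq> z'"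
    using assms(1-4) E_V E_irrefl by blast+
  have nE: "\<not> E u' u" "\<not> E w' w" "\<not> E u u" "\<not> E w w" "\<not> E u' u'" "\<not> E w' w'"
    using assms(13,14) E_sym E_irrefl by blast+
  show thesis
  proof (rule rainbow_extend[of "{u, u'}" "{w, w'}" "{z, z'}"])
    show "{u, u'} \<inter> {w, w'} = {}" "{z, z'} \<inter> ({u, u'} \<union> {w, w'}) = {}"
      using assms ne by blast+
  qed (use V nE assms that in simp_all)
qed

section \<open>Cliques and the sum of the two weights\<close>

text \<open>Each of the two independent colour classes meets a clique in at most one vertex.\<close>

lemma card_clique_rainbow:
  assumes "rainbow_pair V E I J" "\<forall>u\<in>K. \<forall>v\<in>K. u \<noteq> v \<longrightarrow> E u v" "K \<subseteq> V"
  shows "card ((I \<union> J) \<inter> K) \<le> 2"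
proof -
  have "finite (I \<inter> K)" "finite (J \<inter> K)"
    using assms(3) finite_V by (auto intro: finite_subset)
  moreover have "\<forall>u\<in>I \<inter> K. \<forall>v\<in>I \<inter> K. u = v" "\<forall>u\<in>J \<inter> K. \<forall>v\<in>J \<inter> K. u = v"
    using assms(1,2) unfolding rainbow_pair_def by blast+
  ultimately have "card (I \<inter> K) \<le> 1" "card (J \<inter> K) \<le> 1"
    by (simp_all add: card_le_Suc0_iff_eq)
  moreover have "(I \<union> J) \<inter> K = (I \<inter> K) \<union> (J \<inter> K)"
    by auto
  ultimately show ?thesis
    by (metis add_mono card_Un_le le_trans one_add_one)
qed

lemma rainbow_co_clique:
  assumes "rainbow_pair V (co V E) A B"
  shows "A \<subseteq> V" "B \<subseteq> V" "\<And>u v. u \<in> A \<Longrightarrow> v \<in> A \<Longrightarrow> u \<noteq> v \<Longrightarrow> E u v"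
    "\<And>u v. u \<in> B \<Longrightarrow> v \<in> B \<Longrightarrow> u \<noteq> v \<Longrightarrow> E u v"
proof -
  show "A \<subseteq> V" "B \<subseteq> V"
    using assms by (auto simp: rainbow_pair_def)
  then show "\<And>u v. u \<in> A \<Longrightarrow> v \<in> A \<Longrightarrow> u \<noteq> v \<Longrightarrow> E u v" "\<And>u v. u \<in> B \<Longrightarrow> v \<in> B \<Longrightarrow> u \<noteq> v \<Longrightarrow> E u v"
    using assms by (metis co_def rainbow_pair_def subsetD)+
qed

lemma goodI:
  assumes "rainbow_pair V E I J" "rainbow_pair V (co V E) A B"
    and "card (I \<union> J) + card (A \<union> B) \<le> card V + 2"
  shows "good V E"
  using assms unfolding good_def by blast

text \<open>The two supports together miss \<open>z\<close> and \<open>z'\<close>. They overlap in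
  at most 4 vertices, since each of the cliques \<open>A\<close> and \<open>B\<close> meets
  \<open>I \<union> J\<close> in at most 2. So the weights add up to at most (n - 2) + 4.\<close>

lemma double_null_good:
  assumes "z \<in> V" "z' \<in> V" "z \<noteq> z'"
    and "E z u" "E z w" "E z' u'" "E z' w'"
    and "u \<noteq> z'" "w \<noteq> z'" "u' \<noteq> z" "w' \<noteq> z" "u \<noteq> w" "u' \<noteq> w'" "u \<noteq> w'" "w \<noteq> u'"
    and "\<not> E u u'" "\<not> E w w'"
    and "{x, y, x', y'} \<subseteq> V - {z, z'}" "\<not> E z x" "\<not> E z y" "\<not> E z' x'" "\<not> E z' y'"
    and "x \<noteq> y" "x' \<noteq> y'" "x \<noteq> y'" "y \<noteq> x'" "x = x' \<or> E x x'" "y = y' \<or> E y y'"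
  shows "good V E"
proof -
  interpret co: sgraph V "co V E"
    by (rule sgraph_co)
  obtain I J where IJ: "rainbow_pair V E I J" "z \<notin> I \<union> J" "z' \<notin> I \<union> J"
    using rainbow_null_pair[of z u w z' u' w'] assms(4-17) by metis
  obtain A B where AB: "rainbow_pair V (co V E) A B" "z \<notin> A \<union> B" "z' \<notin> A \<union> B"
  proof (rule co.rainbow_null_pair[of z x y z' x' y'])
  qed (use assms(1-3,18-28) in \<open>auto simp: co_def\<close>)
  have fin: "finite (I \<union> J)" "finite (A \<union> B)"
    using IJ AB finite_V by (auto simp: rainbow_pair_def intro: finite_subset)
  have cliques: "A \<subseteq> V" "B \<subseteq> V" "\<forall>u\<in>A. \<forall>v\<in>A. u \<noteq> v \<longrightarrow> E u v" "\<forall>u\<in>B. \<forall>v\<in>B. u \<noteq> v \<longrightarrow> E u v"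
    using rainbow_co_clique[OF AB(1)] by auto
  have "card ((I \<union> J) \<inter> (A \<union> B)) \<le> card ((I \<union> J) \<inter> A) + card ((I \<union> J) \<inter> B)"
    by (metis Int_Un_distrib card_Un_le)
  also have "\<dots> \<le> 4"
    using card_clique_rainbow[OF IJ(1)] cliques by (metis add_mono numeral_Bit0)
  finally have "card ((I \<union> J) \<inter> (A \<union> B)) \<le> 4" .
  moreover have "card ((I \<union> J) \<union> (A \<union> B)) \<le> card (V - {z, z'})"
    using IJ AB finite_V by (intro card_mono) (auto simp: rainbow_pair_def)
  moreover have "card (V - {z, z'}) + 2 = card V"
    using assms(1-3) finite_V card_mono[of V "{z, z'}"] by (simp add: card_Diff_subset)
  moreover have "card (I \<union> J) + card (A \<union> B) =
      card ((I \<union> J) \<union> (A \<union> B)) + card ((I \<union> J) \<inter> (A \<union> B))"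
    using fin by (rule card_Un_Int)
  ultimately have "card (I \<union> J) + card (A \<union> B) \<le> card V + 2"
    by linarith
  then show ?thesis
    using IJ AB unfolding good_def by blast
qed

section \<open>Graphs with a simplicial vertex\<close>

text \<open>The 2RiDF of the complement has weight \<open>card B + 1\<close>, and \<open>B\<close>
  meets \<open>I \<union> J\<close> in at most 2 vertices, so any 2RiDF of the graph yields n + 3.
  The cases gain the missing unit: from a vertex outside \<open>B\<close> forced to colour 0, from
  \<open>B\<close> being small, or from a better 2RiDF of one of the graphs.\<close>

lemma simplicial_good:
  assumes a: "a \<in> V" and simplicial: "\<And>u w. E a u \<Longrightarrow> E a w \<Longrightarrow> u \<noteq> w \<Longrightarrow> E u w"
  shows "good V E"
proof -
  interpret co: sgraph V "co V E"
    by (rule sgraph_co)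
  obtain A B where AB: "rainbow_pair V (co V E) A B" "{a} \<subseteq> A" "{v. E a v} \<subseteq> B"
  proof (rule co.rainbow_extend[of "{a}" "{v. E a v}" "{}"])
    show "{v. E a v} \<subseteq> V" "{a} \<inter> {v. E a v} = {}"
      using E_V E_irrefl by blast+
    show "\<forall>u\<in>{v. E a v}. \<forall>v\<in>{v. E a v}. \<not> co V E u v"
      using simplicial by (auto simp: co_def)
  qed (use a in \<open>auto simp: co_def\<close>)
  note cliques = rainbow_co_clique[OF AB(1)]
  have disj: "A \<inter> B = {}"
    using AB(1) by (simp add: rainbow_pair_def)
  \<comment> \<open>Further members of the clique \<open>A\<close> would be neighbours of
    \<open>a\<close>, but these lie in \<open>B\<close>.\<close>
  have "A = {a}"
    using AB(2,3) disj cliques(3)[of a] by blast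
  have aB: "a \<notin> B"
    using AB(2) disj by blast
  have finB: "finite B"
    using cliques(2) finite_V by (rule finite_subset)
  have cardAB: "card (A \<union> B) = card B + 1"
    using \<open>A = {a}\<close> aB finB by simp
  \<comment> \<open>\<open>Z\<close> collects vertices known to have colour 0: they enlarge the
    union of \<open>I \<union> J\<close> and \<open>B \<union> Z\<close>, but not the
    intersection.\<close>
  have cardIJ: "card (I \<union> J) + card (B \<union> Z) \<le> card V + 2"
    if IJ: "rainbow_pair V E I J" and Z: "Z \<subseteq> V" "Z \<inter> (I \<union> J) = {}" for I J Z
  proof -
    have "I \<union> J \<subseteq> V"
      using IJ by (auto simp: rainbow_pair_def)
    then have "card ((I \<union> J) \<union> (B \<union> Z)) \<le> card V"
      using cliques(2) Z finite_V by (intro card_mono) auto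
    moreover have "(I \<union> J) \<inter> (B \<union> Z) = (I \<union> J) \<inter> B"
      using Z by blast
    moreover have "card ((I \<union> J) \<inter> B) \<le> 2"
      using card_clique_rainbow[OF IJ _ cliques(2)] cliques(4) by blast
    moreover have "finite (I \<union> J)" "finite (B \<union> Z)"
      using \<open>I \<union> J \<subseteq> V\<close> cliques(2) Z finite_V by (auto intro: finite_subset)
    ultimately show ?thesis
      using card_Un_Int[of "I \<union> J" "B \<union> Z"] by simp
  qed
  have cardV: "card (I \<union> J) + card Z \<le> card V"
    if IJ: "rainbow_pair V E I J" and Z: "Z \<subseteq> V" "Z \<inter> (I \<union> J) = {}" for I J Z
  proof -
    have "(I \<union> J) \<union> Z \<subseteq> V"
      using IJ Z by (auto simp: rainbow_pair_def)
    moreover from this have "finite (I \<union> J)" "finite Z"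
      using finite_V by (auto intro: finite_subset)
    moreover have "(I \<union> J) \<inter> Z = {}"
      using Z by blast
    ultimately show ?thesis
      using card_mono[OF finite_V, of "(I \<union> J) \<union> Z"] by (metis card_Un_disjoint)
  qed
  obtain I J where IJ: "rainbow_pair V E I J"
    by (rule rainbow_exists)
  consider
      (deg2) z u w where "z \<in> V" "z \<notin> B" "E z u" "E z w" "u \<noteq> w"
    | (small) "card B \<le> 1"
    | (two) "card B = 2" "\<And>z u w. z \<in> V \<Longrightarrow> z \<notin> B \<Longrightarrow> E z u \<Longrightarrow> E z w \<Longrightarrow> u = w"
    | (large) "card B \<ge> 3" "\<And>z u w. z \<in> V \<Longrightarrow> z \<notin> B \<Longrightarrow> E z u \<Longrightarrow> E z w \<Longrightarrow> u = w"
    by (metis One_nat_def Suc_leI linorder_not_less nat_less_le numeral_2_eq_2 numeral_3_eq_3)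
  then show ?thesis
  proof cases
    case deg2
    obtain I J where IJ: "rainbow_pair V E I J" "z \<notin> I \<union> J"
      using rainbow_seed deg2 by metis
    have "card (I \<union> J) + card (B \<union> {z}) \<le> card V + 2"
      using cardIJ[OF IJ(1), of "{z}"] IJ(2) deg2(1) by simp
    then show ?thesis
      using goodI[OF IJ(1) AB(1)] cardAB deg2(2) finB by simp
  next
    case small
    then show ?thesis
      using goodI[OF IJ AB(1)] cardV[OF IJ, of "{}"] cardAB by simp
  next
    case two
    then obtain b c where bc: "B = {b, c}" "b \<noteq> c"
      by (meson card_2_iff)
    then have Ebc: "E b c" "E c b"
      using cliques(4)[of b c] E_sym by auto
    show ?thesis
    \<comment> \<open>Either a vertex of \<open>B\<close> can be forced to colour 0, which leaves
      weight at most n - 1 in the graph, or \<open>b\<close> and \<open>c\<close> form an isolated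
      edge and \<open>{b}\<close>, \<open>{c}\<close> is a 2RiDF of the complement of weight
      2.\<close>
    proof (cases "\<exists>z\<in>B. \<exists>u w. E z u \<and> E z w \<and> u \<noteq> w")
      case True
      then obtain z u w where z: "z \<in> V" "E z u" "E z w" "u \<noteq> w"
        using E_V by blast
      then obtain I J where IJ: "rainbow_pair V E I J" "z \<notin> I \<union> J"
        using rainbow_seed by metis
      have "card (I \<union> J) + 1 \<le> card V"
        using cardV[OF IJ(1), of "{z}"] IJ(2) z(1) by simp
      then show ?thesis
        using goodI[OF IJ(1) AB(1)] cardAB two(1) by simp
    next
      case False
      then have "\<And>v. E b v \<Longrightarrow> v = c" "\<And>v. E c v \<Longrightarrow> v = b"
        using bc Ebc by blast+
      then have "\<And>v. v \<noteq> c \<Longrightarrow> \<not> E v b" "\<And>v. v \<noteq> b \<Longrightarrow> \<not> E v c"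
        using E_sym by blast+
      then have "rainbow_pair V (co V E) {b} {c}"
        using bc cliques(2) by (auto simp: rainbow_pair_def co_def)
      then show ?thesis
        using goodI[OF IJ, of "{b}" "{c}"] cardV[OF IJ, of "{}"] bc(2) by simp
    qed
  next
    case large
    show ?thesis
    proof (cases "\<forall>b\<in>B. \<exists>r. E b r \<and> r \<notin> B")
      case True
      then obtain r where r: "\<And>b. b \<in> B \<Longrightarrow> E b (r b)" "\<And>b. b \<in> B \<Longrightarrow> r b \<notin> B"
        by metis
      have rV: "b \<in> B \<Longrightarrow> r b \<in> V" for b
        using r(1) E_V by blast
      have r_deg: "b \<in> B \<Longrightarrow> E (r b) v \<Longrightarrow> v = b" for b v
        using large(2) rV r E_sym by metis
      obtain b where b: "b \<in> B"
        using large(1) by (metis card.empty ex_in_conv not_numeral_le_zero)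
      \<comment> \<open>The neighbours chosen by \<open>r\<close> have degree 1. Those of
        \<open>B - {b}\<close> as one seed and \<open>b\<close> as the other force colour 0 on all
        of \<open>B - {b}\<close>, so the total is at most (n - card B + 1) + (card B + 1).\<close>
      obtain I J where IJ: "rainbow_pair V E I J" "(B - {b}) \<inter> (I \<union> J) = {}"
      proof (rule rainbow_extend[of "r ` (B - {b})" "{b}" "B - {b}"])
        show "\<forall>u\<in>r ` (B - {b}). \<forall>v\<in>r ` (B - {b}). \<not> E u v"
          using r_deg r(2) by blast
        show "\<forall>z\<in>B - {b}. (\<exists>u\<in>r ` (B - {b}). E z u) \<and> (\<exists>u\<in>{b}. E z u)"
          using r(1) b cliques(4) by blast
        show "(B - {b}) \<inter> (r ` (B - {b}) \<union> {b}) = {}" "r ` (B - {b}) \<inter> {b} = {}"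
          using r(2) b by blast+
        show "r ` (B - {b}) \<subseteq> V" "{b} \<subseteq> V"
          using rV b cliques(2) by blast+
      qed (use E_irrefl in simp_all)
      have "card (I \<union> J) + card (B - {b}) \<le> card V"
        using cardV[OF IJ(1), of "B - {b}"] IJ(2) cliques(2) by blast
      then show ?thesis
        using goodI[OF IJ(1) AB(1)] cardAB b finB large(1) by simp
    next
      case False
      \<comment> \<open>Since \<open>b\<close> has no neighbour outside \<open>B\<close>, the set
        \<open>B\<close> split into \<open>{b}\<close> and \<open>B - {b}\<close> suffices for the
        complement: a vertex outside \<open>B\<close> has at most one neighbour in the graph, while
        \<open>B - {b}\<close> has at least two members.\<close>
      then obtain b where b: "b \<in> B" "\<And>v. E b v \<Longrightarrow> v \<in> B"
        by blast
      have "\<exists>u\<in>B - {b}. co V E v u" if v: "v \<in> V" "v \<notin> B" for v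
      proof (rule ccontr)
        assume "\<not> ?thesis"
        then have "u \<in> B - {b} \<Longrightarrow> E v u" for u
          using v cliques(2) by (auto simp: co_def)
        then have "\<forall>u\<in>B - {b}. \<forall>w\<in>B - {b}. u = w"
          using large(2)[OF v] by blast
        then have "card (B - {b}) \<le> 1"
          using finB by (simp add: card_le_Suc0_iff_eq)
        then show False
          using large(1) b(1) finB by simp
      qed
      moreover have "co V E v b" if "v \<in> V" "v \<notin> B" for v
        using that b cliques(2) by (auto simp: co_def dest: E_sym)
      moreover have "\<forall>u\<in>B - {b}. \<forall>v\<in>B - {b}. \<not> co V E u v"
        using cliques(4) by (auto simp: co_def)
      moreover have "\<not> co V E b b"
        by (simp add: co_def)
      ultimately have "rainbow_pair V (co V E) {b} (B - {b})"
        using b(1) cliques(2) by (auto simp: rainbow_pair_def)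
      moreover have "{b} \<union> (B - {b}) = B"
        using b by blast
      ultimately show ?thesis
        using goodI[OF IJ, of "{b}" "B - {b}"] cardIJ[OF IJ, of "{}"] by simp
    qed
  qed
qed

end

section \<open>Counterexamples\<close>

definition ind_C4 :: "('a \<Rightarrow> 'a \<Rightarrow> bool) \<Rightarrow> 'a \<Rightarrow> 'a \<Rightarrow> 'a \<Rightarrow> 'a \<Rightarrow> bool" where
  "ind_C4 E p q r s \<longleftrightarrow> E p q \<and> E q r \<and> E r s \<and> E s p \<and> \<not> E p r \<and> \<not> E q s \<and> p \<noteq> r \<and> q \<noteq> s"

text \<open>In a simple graph these edges and nonedges force the five vertices to be distinct.
  Opposite vertices of a 4-cycle have the same neighbours on it, so \<open>ind_C4\<close> has to
  separate them explicitly.\<close>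

definition ind_C5 :: "('a \<Rightarrow> 'a \<Rightarrow> bool) \<Rightarrow> 'a \<Rightarrow> 'a \<Rightarrow> 'a \<Rightarrow> 'a \<Rightarrow> 'a \<Rightarrow> bool" where
  "ind_C5 E a b c d e \<longleftrightarrow> E a b \<and> E b c \<and> E c d \<and> E d e \<and> E e a \<and>
     \<not> E a c \<and> \<not> E b d \<and> \<not> E c e \<and> \<not> E d a \<and> \<not> E e b"

definition ind_2K2 :: "('a \<Rightarrow> 'a \<Rightarrow> bool) \<Rightarrow> 'a \<Rightarrow> 'a \<Rightarrow> 'a \<Rightarrow> 'a \<Rightarrow> bool" where
  "ind_2K2 E a b c d \<longleftrightarrow> E a b \<and> E c d \<and> \<not> E a c \<and> \<not> E a d \<and> \<not> E b c \<and> \<not> E b d"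

locale bad_graph = sgraph +
  assumes not_good: "\<not> good V E"
begin

text \<open>Lets the whole locale be interpreted again for the complement.\<close>

lemma bad_co: "bad_graph V (co V E)"
  using sgraph_co not_good good_co by (simp add: bad_graph_def bad_graph_axioms_def)

lemma nonsimplicial:
  assumes "a \<in> V"
  obtains u w where "E a u" "E a w" "u \<noteq> w" "\<not> E u w"
  using assms simplicial_good not_good by blast

lemma nonsimplicial_co:
  assumes "a \<in> V"
  obtains x y where "x \<in> V" "y \<in> V" "x \<noteq> a" "y \<noteq> a" "\<not> E a x" "\<not> E a y" "E x y"
proof -
  interpret co: bad_graph V "co V E"
    by (rule bad_co)
  show thesis
    using co.nonsimplicial[OF assms] that unfolding co_def by metis
qed

text \<open>The vertices \<open>z, z'\<close> get colour 0 in both graphs; \<open>u, u'\<close> and \<open>w, w'\<close> are the seeds of the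
  colour classes in the graph, \<open>x, x'\<close> and \<open>y, y'\<close> those in the complement.\<close>

lemma no_double_null:
  assumes "E z u" "E z w" "E z' u'" "E z' w'" "z \<noteq> z'"
    and "u \<noteq> z'" "w \<noteq> z'" "u' \<noteq> z" "w' \<noteq> z" "u \<noteq> w" "u' \<noteq> w'" "u \<noteq> w'" "w \<noteq> u'"
    and "\<not> E u u'" "\<not> E w w'"
    and "x \<in> V" "y \<in> V" "x' \<in> V" "y' \<in> V"
    and "x \<noteq> z" "y \<noteq> z" "x' \<noteq> z" "y' \<noteq> z" "x \<noteq> z'" "y \<noteq> z'" "x' \<noteq> z'" "y' \<noteq> z'"
    and "\<not> E z x" "\<not> E z y" "\<not> E z' x'" "\<not> E z' y'"
    and "x \<noteq> y" "x' \<noteq> y'" "x \<noteq> y'" "y \<noteq> x'" "x = x' \<or> E x x'" "y = y' \<or> E y y'"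
  shows False
proof -
  have "z \<in> V" "z' \<in> V"
    using assms(1,3) E_V by blast+
  moreover have "{x, y, x', y'} \<subseteq> V - {z, z'}"
    using assms(16-27) by blast
  ultimately show False
    using double_null_good[of z z' u w u' w' x y x' y'] assms not_good by blast
qed

section \<open>Long holes and Dirac's argument\<close>

definition nonnbrs :: "'a \<Rightarrow> 'a set" where
  "nonnbrs a = {v \<in> V. v \<noteq> a \<and> \<not> E a v}"

definition step :: "'a \<Rightarrow> ('a \<times> 'a) set" where
  "step a = {(x, y). x \<in> nonnbrs a \<and> y \<in> nonnbrs a \<and> E x y}"

text \<open>For \<open>c \<in> nonnbrs a\<close>, the component of \<open>c\<close> in the subgraph induced by the vertices
  not adjacent to \<open>a\<close>.\<close>

definition comp :: "'a \<Rightarrow> 'a \<Rightarrow> 'a set" where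
  "comp a c = (step a)\<^sup>* `` {c}"

lemma comp_subset:
  assumes "c \<in> nonnbrs a"
  shows "comp a c \<subseteq> nonnbrs a"
proof
  fix x assume "x \<in> comp a c"
  then have "(c, x) \<in> (step a)\<^sup>*"
    by (simp add: comp_def)
  then show "x \<in> nonnbrs a"
    by (induction rule: rtrancl_induct) (use assms in \<open>auto simp: step_def\<close>)
qed

lemma comp_step:
  assumes "x \<in> comp a c" "(x, y) \<in> step a"
  shows "y \<in> comp a c"
  using assms by (auto simp: comp_def intro: rtrancl_into_rtrancl)

text \<open>If \<open>s\<close> and \<open>t\<close> were not adjacent, a shortest path through the
  non-neighbours of \<open>a\<close> would close up with \<open>s\<close>, \<open>a\<close>,
  \<open>t\<close> to an induced cycle on \<open>k + 4\<close> vertices. Lengths 4 and 5 are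
  excluded by assumption, longer ones by \<open>no_double_null\<close>.\<close>

lemma separator_clique:
  assumes no4: "\<And>p q r s. \<not> ind_C4 E p q r s" and no5: "\<And>p q r s t. \<not> ind_C5 E p q r s t"
    and c: "c \<in> nonnbrs a"
    and s: "E a s" "x \<in> comp a c" "E s x"
    and t: "E a t" "y \<in> comp a c" "E t y" "s \<noteq> t"
  shows "E s t"
proof (rule ccontr)
  assume st: "\<not> E s t"
  have "sym (step a)"
    by (auto simp: step_def sym_def dest: E_sym)
  then have "(x, c) \<in> (step a)\<^sup>*"
    using s(2) by (metis Image_singleton_iff comp_def symE sym_rtrancl)
  then have "(x, y) \<in> (step a)\<^sup>*"
    using t(2) by (auto simp: comp_def)
  then obtain k0 where k0: "(x, y) \<in> step a ^^ k0"
    using rtrancl_power by blast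
  \<comment> \<open>The length is minimised over all end vertices \<open>x\<close>, \<open>y\<close>
    among the non-neighbours of \<open>a\<close>, so that any chord, or any inner vertex adjacent to
    \<open>s\<close> or \<open>t\<close>, gives a shorter path.\<close>
  define Q where "Q k \<longleftrightarrow> (\<exists>x y. x \<in> nonnbrs a \<and> y \<in> nonnbrs a \<and> E s x \<and> E t y \<and> (x, y) \<in> step a ^^ k)" for k
  have "Q k0"
    using k0 s t comp_subset[OF c] unfolding Q_def by blast
  define k where "k = (LEAST k. Q k)"
  have "Q k"
    unfolding k_def using \<open>Q k0\<close> by (rule LeastI)
  have min: "k \<le> j" if "Q j" for j
    unfolding k_def using that by (rule Least_le)
  obtain x y where xy: "x \<in> nonnbrs a" "y \<in> nonnbrs a" "E s x" "E t y" "(x, y) \<in> step a ^^ k"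
    using \<open>Q k\<close> unfolding Q_def by blast
  then obtain f where f: "f 0 = x" "f k = y" "\<And>i. i < k \<Longrightarrow> (f i, f (Suc i)) \<in> step a"
    using relpow_fun_conv[of x y k "step a"] by blast
  have f_in: "f i \<in> nonnbrs a" if "i \<le> k" for i
    using that f xy(1,2) by (cases "i = k") (auto simp: step_def)
  have seg: "(f i, f j) \<in> step a ^^ (j - i)" if "i \<le> j" "j \<le> k" for i j
    unfolding relpow_fun_conv using that f(3)
    by (intro exI[of _ "\<lambda>l. f (i + l)"]) auto
  have s_adj: "i = 0" if "i \<le> k" "E s (f i)" for i
  proof -
    have "Q (k - i)"
      unfolding Q_def using that xy f seg[of i k] f_in by blast
    from min[OF this] show ?thesis
      using that by simp
  qed
  have t_adj: "i = k" if "i \<le> k" "E t (f i)" for i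
  proof -
    have "Q i"
      unfolding Q_def using that xy f seg[of 0 i] f_in[OF that(1)] by auto
    from min[OF this] show ?thesis
      using that by simp
  qed
  have f_adj: "j = Suc i" if "i < j" "j \<le> k" "E (f i) (f j)" for i j
  proof -
    have "(f i, f j) \<in> step a"
      using that f_in by (simp add: step_def)
    then have "(f 0, f j) \<in> step a ^^ Suc i"
      using seg[of 0 i] that by auto
    then have "(x, y) \<in> step a ^^ (Suc i + (k - j))"
      unfolding relpow_add using seg[of j k] that f(1,2) by blast
    then have "Q (Suc i + (k - j))"
      unfolding Q_def using xy by blast
    from min[OF this] show ?thesis
      using that by simp
  qed
  have f_inj: "f i \<noteq> f j" if "i < j" "j \<le> k" for i j
  proof
    assume eq: "f i = f j"
    then have "(x, y) \<in> step a ^^ (i + (k - j))"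
      unfolding relpow_add using seg[of 0 i] seg[of j k] that f(1,2) by auto
    then have "Q (i + (k - j))"
      unfolding Q_def using xy by blast
    from min[OF this] show False
      using that by simp
  qed
  have s_nadj: "\<not> E s (f i)" "\<not> E (f i) s" if "0 < i" "i \<le> k" for i
    using s_adj[of i] that E_sym[of "f i" s] by auto
  have t_nadj: "\<not> E t (f i)" "\<not> E (f i) t" if "i < k" for i
    using t_adj[of i] that E_sym[of "f i" t] by auto
  have a_f: "f i \<in> V" "f i \<noteq> a" "\<not> E a (f i)" "\<not> E (f i) a" if "i \<le> k" for i
    using f_in[OF that] E_sym[of "f i" a] by (auto simp: nonnbrs_def)
  have f_s: "f i \<noteq> s" "f i \<noteq> t" if "i \<le> k" for i
    using a_f[OF that] s(1) t(1) by blast+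
  have Ef: "E (f i) (f (Suc i))" "E (f (Suc i)) (f i)" if "i < k" for i
    using f(3)[OF that] by (auto simp: step_def dest: E_sym)
  have E0: "E s (f 0)" "E (f 0) s" "E t (f k)" "E (f k) t" "E s a" "E t a" "\<not> E t s"
    using f xy s t st E_sym by blast+
  have Vs: "s \<in> V" "t \<in> V" "a \<noteq> s" "a \<noteq> t"
    using s(1) t(1) E_V E_irrefl by blast+
  consider "k = 0" | "k = 1" | "k = 2" | "k \<ge> 3"
    by linarith
  then show False
  proof cases
    case 1
    then have "ind_C4 E a s (f 0) t"
      using a_f[of 0] E0 s(1) t(4) st by (auto simp: ind_C4_def)
    then show False
      using no4 by blast
  next
    case 2
    then have "ind_C5 E a s (f 0) (f 1) t"
      using a_f[of 0] a_f[of 1] E0 Ef[of 0] s(1) t(1) st s_nadj[of 1] t_nadj[of 0]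
      by (simp add: ind_C5_def)
    then show False
      using no5 by blast
  next
    case 3
    have "E (f 1) (f 0)" "E (f 1) (f 2)" "E (f 2) t"
      using Ef[of 0] Ef[of 1] E0 3 by (simp_all add: numeral_2_eq_2)
    moreover have "f 0 \<noteq> f 2" "f 1 \<noteq> f 0" "f 1 \<noteq> f 2"
      using f_inj[of 0 2] f_inj[of 0 1] f_inj[of 1 2] 3 by auto
    \<comment> \<open>In the 6-cycle the opposite vertices \<open>a\<close> and \<open>f 1\<close>
      receive colour 0 in both graphs.\<close>
    ultimately show False
      using no_double_null[of a s t "f 1" "f 2" "f 0" "f 0" "f 2" s t] a_f[of 0] a_f[of 1] a_f[of 2]
        f_s[of 0] f_s[of 1] f_s[of 2] s_nadj[of 1] s_nadj[of 2] t_nadj[of 0] t_nadj[of 1] E0 Vs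
        s(1) t(1,4) 3
      by simp
  next
    case 4
    have "E (f 1) (f 0)" "E (f 1) (f 2)"
      using Ef[of 0] Ef[of 1] 4 by (simp_all add: numeral_2_eq_2)
    moreover have "f 0 \<noteq> f 2" "f 1 \<noteq> f 0" "f 1 \<noteq> f 2" "f 0 \<noteq> f 3" "f 1 \<noteq> f 3"
      using f_inj[of 0 2] f_inj[of 0 1] f_inj[of 1 2] f_inj[of 0 3] f_inj[of 1 3] 4 by auto
    moreover have "\<not> E (f 1) (f 3)"
      using f_adj[of 1 3] 4 by auto
    \<comment> \<open>The same two vertices work; \<open>f 3\<close>, adjacent to neither, now
      serves as the common seed \<open>y = y'\<close>.\<close>
    ultimately show False
      using no_double_null[of a s t "f 1" "f 2" "f 0" "f 0" "f 3" s "f 3"] a_f[of 0] a_f[of 1]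
        a_f[of 2] a_f[of 3] f_s[of 0] f_s[of 1] f_s[of 2] f_s[of 3] s_nadj[of 1] s_nadj[of 2]
        t_nadj[of 0] E0 Vs s(1) t(1,4) 4
      by simp
  qed
qed

text \<open>Dirac's argument: if separators are cliques, a smallest component of a set of
  non-neighbours contains a simplicial vertex.\<close>

lemma C4_or_C5:
  assumes "V \<noteq> {}"
  shows "(\<exists>p q r s. ind_C4 E p q r s) \<or> (\<exists>p q r s t. ind_C5 E p q r s t)"
proof (rule ccontr)
  assume "\<not> ?thesis"
  then have no: "\<And>p q r s. \<not> ind_C4 E p q r s" "\<And>p q r s t. \<not> ind_C5 E p q r s t"
    by blast+
  obtain v0 where "v0 \<in> V"
    using assms by blast
  then obtain u0 w0 where "E v0 u0" "E v0 w0" "u0 \<noteq> w0" "\<not> E u0 w0"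
    by (rule nonsimplicial)
  then have "w0 \<in> nonnbrs u0"
    using E_V by (auto simp: nonnbrs_def)
  define P where "P n \<longleftrightarrow> (\<exists>a c. c \<in> nonnbrs a \<and> card (comp a c) = n)" for n
  have "P (LEAST n. P n)"
    using \<open>w0 \<in> nonnbrs u0\<close> by (intro LeastI[of P "card (comp u0 w0)"]) (auto simp: P_def)
  then obtain a c where ac: "c \<in> nonnbrs a" "card (comp a c) = (LEAST n. P n)"
    unfolding P_def by blast
  have min: "card (comp a c) \<le> card (comp a' c')" if "c' \<in> nonnbrs a'" for a' c'
    unfolding ac(2) by (rule Least_le) (use that P_def in blast)
  define C where "C = comp a c"
  \<comment> \<open>\<open>S\<close> separates \<open>C\<close> from the rest: by
    \<open>nbr\<close>, edges leaving \<open>C\<close> end in \<open>S\<close>.\<close>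
  define S where "S = {s. E a s \<and> (\<exists>x\<in>C. E s x)}"
  have CV: "C \<subseteq> V" "C \<subseteq> nonnbrs a"
    using comp_subset[OF ac(1)] by (auto simp: C_def nonnbrs_def)
  have nbr: "y \<in> C \<union> S" if "x \<in> C" "E x y" for x y
  proof (cases "y \<in> nonnbrs a")
    case True
    then have "(x, y) \<in> step a"
      using that CV by (auto simp: step_def)
    then show ?thesis
      using comp_step that unfolding C_def by blast
  next
    case False
    have "y \<noteq> a"
      using that CV by (auto simp: nonnbrs_def dest: E_sym)
    then have "E a y"
      using False that(2) E_V by (auto simp: nonnbrs_def)
    then show ?thesis
      using that by (auto simp: S_def dest: E_sym)
  qed
  have S_clique: "E s t" if "s \<in> S" "t \<in> S" "s \<noteq> t" for s t
    using that separator_clique[OF no ac(1)] unfolding S_def C_def by blast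
  \<comment> \<open>The component of \<open>c'\<close> among the non-neighbours of \<open>d\<close>
    cannot leave \<open>C\<close> through \<open>S\<close>, because \<open>d\<close> equals or is
    adjacent to every vertex of \<open>S\<close>. It would be a proper subset of \<open>C\<close>,
    against minimality.\<close>
  have shrink: False if d: "d \<in> C \<union> S" "c' \<in> C" "d \<noteq> c'" "\<not> E d c'"
    and full: "d \<in> S \<or> (\<forall>s\<in>S. E d s)" for d c'
  proof -
    have c': "c' \<in> nonnbrs d"
      using d CV by (auto simp: nonnbrs_def)
    have "x \<in> C" if "(c', x) \<in> (step d)\<^sup>*" for x
      using that
    proof (induction rule: rtrancl_induct)
      case (step x y)
      then have "y \<in> C \<union> S" "y \<in> nonnbrs d"
        using nbr[of x y] by (auto simp: step_def)
      moreover have "y \<notin> S"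
        using \<open>y \<in> nonnbrs d\<close> full S_clique by (auto simp: nonnbrs_def)
      ultimately show ?case
        by blast
    qed (use d in simp)
    then have "comp d c' \<subseteq> C"
      by (auto simp: comp_def)
    \<comment> \<open>The witness is \<open>d\<close> itself if \<open>d\<close> lies in
      \<open>C\<close>, and otherwise a neighbour of \<open>d\<close> in \<open>C\<close>.\<close>
    moreover have "\<exists>x\<in>C. x \<notin> nonnbrs d"
      using d(1) by (auto simp: S_def nonnbrs_def)
    ultimately have "comp d c' \<subset> C"
      using comp_subset[OF c'] by blast
    then have "card (comp d c') < card (comp a c)"
      using CV finite_V unfolding C_def by (meson finite_subset psubset_card_mono)
    then show False
      using min[OF c'] by simp
  qed
  have SC: "E s x" if "s \<in> S" "x \<in> C" for s x
  proof (rule ccontr)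
    assume "\<not> E s x"
    moreover have "s \<noteq> x"
      using that CV by (auto simp: S_def nonnbrs_def)
    ultimately show False
      using shrink[of s x] that by blast
  qed
  have CC: "E x y" if "x \<in> C" "y \<in> C" "x \<noteq> y" for x y
    using shrink[of x y] that SC E_sym by blast
  \<comment> \<open>Now \<open>C \<union> S\<close> is a clique containing all neighbours of
    \<open>c\<close>, which is therefore simplicial.\<close>
  have "c \<in> C"
    by (simp add: C_def comp_def)
  then have "c \<in> V"
    using CV by blast
  then obtain u w where "E c u" "E c w" "u \<noteq> w" "\<not> E u w"
    by (rule nonsimplicial)
  then show False
    using nbr[OF \<open>c \<in> C\<close>] S_clique SC CC E_sym by (metis UnE)
qed

subsection \<open>Induced 4-cycles and induced \<open>2K\<^sub>2\<close>\<close>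

text \<open>One of \<open>c\<close>, \<open>d\<close> is adjacent to \<open>r\<close>
  (\<open>k1\<close>); either way \<open>b\<close> is adjacent to both \<open>q\<close> and
  \<open>s\<close>, which \<open>k3\<close> forbids.\<close>

lemma C4_2K2_share_vertex:
  assumes C4: "ind_C4 E p q r s" and K: "E p b" "E c d" "\<not> E p c" "\<not> E p d" "\<not> E b c" "\<not> E b d"
    and disj: "{b, c, d} \<inter> {q, r, s} = {}"
  shows False
proof -
  have V: "p \<in> V" "q \<in> V" "r \<in> V" "s \<in> V" "b \<in> V" "c \<in> V" "d \<in> V"
    using C4 K E_V unfolding ind_C4_def by blast+
  have dist: "distinct [p, q, r, s, b, c, d]"
    using C4 K disj E_irrefl E_sym unfolding ind_C4_def by auto
  note facts = C4[unfolded ind_C4_def] K V dist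
  have k1: "E c r \<or> E d r"
    using no_double_null[of p q s r q s c d c d] facts by (auto simp: E_commute E_irrefl)
  have k2: "E b q \<or> \<not> E c r"
    using no_double_null[of q p r c d r s b p b] facts by (auto simp: E_commute E_irrefl)
  have k3: "\<not> E b q \<or> \<not> E b s"
    using no_double_null[of p q s b q s c d c d] facts by (auto simp: E_commute E_irrefl)
  have k4: "E b s \<or> \<not> E d r"
    using no_double_null[of s p r d c r q b p b] facts by (auto simp: E_commute E_irrefl)
  have k5: "E b q \<or> \<not> E d r"
    using no_double_null[of q p r d c r s b p b] facts by (auto simp: E_commute E_irrefl)
  have k6: "E b s \<or> \<not> E c r"
    using no_double_null[of s p r c d r q b p b] facts by (auto simp: E_commute E_irrefl)
  show False
    using k1 k2 k3 k4 k5 k6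
    by argo
qed

text \<open>The clauses in the next proof were found by a computer search for a small unsatisfiable set of
  instances of \<open>no_double_null\<close>.\<close>

lemma C4_2K2_share_edge_extra:
  assumes C4: "ind_C4 E p q r s" and K: "E c d" "\<not> E p c" "\<not> E p d" "\<not> E q c" "\<not> E q d"
    and v: "v \<in> V" "v \<notin> {p, q, r, s, c, d}"
  shows False
proof -
  have V: "p \<in> V" "q \<in> V" "r \<in> V" "s \<in> V" "v \<in> V" "c \<in> V" "d \<in> V"
    using C4 K v E_V unfolding ind_C4_def by blast+
  have dist: "distinct [p, q, r, s, c, d, v]"
    using C4 K v E_irrefl E_sym unfolding ind_C4_def by auto
  note facts = C4[unfolded ind_C4_def] K V dist
  have k1: "E c r \<or> E d r"
    using no_double_null[of p q s r q s c d c d] facts by (auto simp: E_commute E_irrefl)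
  have k2: "E c s \<or> E d s"
    using no_double_null[of q p r s p r c d c d] facts by (auto simp: E_commute E_irrefl)
  have k3: "\<not> E c s \<or> E c v \<or> \<not> E d v"
    using no_double_null[of p q s c d s r d q v] facts by (auto simp: E_commute E_irrefl)
  have k4: "\<not> E c v \<or> \<not> E d s \<or> E d v"
    using no_double_null[of p q s d c s r c q v] facts by (auto simp: E_commute E_irrefl)
  have k5: "\<not> E c r \<or> E c v \<or> E q v"
    using no_double_null[of q p r c d r s v p v] facts by (auto simp: E_commute E_irrefl)
  have k6: "\<not> E c s \<or> \<not> E q v \<or> E r v"
    using no_double_null[of r q s c d s p v p q] facts by (auto simp: E_commute E_irrefl)
  have k7: "\<not> E c r \<or> E d r \<or> \<not> E q v \<or> \<not> E r v"
    using no_double_null[of q p v r c v s c p d] facts by (auto simp: E_commute E_irrefl)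
  have k8: "\<not> E d r \<or> E d v \<or> E q v"
    using no_double_null[of q p r d c r s v p v] facts by (auto simp: E_commute E_irrefl)
  have k9: "\<not> E d s \<or> \<not> E q v \<or> E r v"
    using no_double_null[of r q s d c s p v p q] facts by (auto simp: E_commute E_irrefl)
  have k10: "\<not> E c r \<or> \<not> E c v \<or> \<not> E d r \<or> \<not> E d v"
    using no_double_null[of c r v d r v p q p q] facts by (auto simp: E_commute E_irrefl)
  have k11: "E c r \<or> \<not> E d r \<or> \<not> E q v \<or> \<not> E r v"
    using no_double_null[of q p v r d v s c p c] facts by (auto simp: E_commute E_irrefl)
  have k12: "\<not> E c v \<or> E d r \<or> E r v"
    using no_double_null[of p q s r q s c d v d] facts by (auto simp: E_commute E_irrefl)
  have k13: "E c r \<or> \<not> E d v \<or> E r v"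
    using no_double_null[of p q s r q s c d c v] facts by (auto simp: E_commute E_irrefl)
  have k14: "\<not> E c s \<or> \<not> E c v \<or> \<not> E d s \<or> \<not> E d v"
    using no_double_null[of c s v d s v p q p q] facts by (auto simp: E_commute E_irrefl)
  have k15: "\<not> E c v \<or> E d s \<or> E s v"
    using no_double_null[of q p r s p r c d v d] facts by (auto simp: E_commute E_irrefl)
  have k16: "E c v \<or> E d v \<or> \<not> E q v \<or> \<not> E s v"
    using no_double_null[of p q s v q s c d c d] facts by (auto simp: E_commute E_irrefl)
  have k17: "E c s \<or> \<not> E d v \<or> E s v"
    using no_double_null[of q p r s p r c d c v] facts by (auto simp: E_commute E_irrefl)
  have k18: "\<not> E c s \<or> E d s \<or> \<not> E p v \<or> \<not> E s v"
    using no_double_null[of p q v s c v r c q d] facts by (auto simp: E_commute E_irrefl)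
  have k19: "E c s \<or> \<not> E d s \<or> \<not> E p v \<or> \<not> E s v"
    using no_double_null[of p q v s d v r c q c] facts by (auto simp: E_commute E_irrefl)
  have k20: "\<not> E c r \<or> E c v \<or> E s v"
    using no_double_null[of s p r c d r q v p v] facts by (auto simp: E_commute E_irrefl)
  have k21: "\<not> E c v \<or> E d v \<or> E p v \<or> \<not> E r v"
    using no_double_null[of q p r v c r s c p d] facts by (auto simp: E_commute E_irrefl)
  have k22: "E c v \<or> \<not> E d v \<or> E p v \<or> \<not> E r v"
    using no_double_null[of q p r v d r s c p c] facts by (auto simp: E_commute E_irrefl)
  have k23: "\<not> E c r \<or> \<not> E d v \<or> E p v \<or> E q v \<or> \<not> E r v"
    using no_double_null[of c r d v r d p q p q] facts by (auto simp: E_commute E_irrefl)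
  have k24: "\<not> E c v \<or> \<not> E d r \<or> E p v \<or> E q v \<or> \<not> E r v"
    using no_double_null[of d r c v r c p q p q] facts by (auto simp: E_commute E_irrefl)
  show False
    using k1 k2 k3 k4 k5 k6 k7 k8 k9 k10 k11 k12 k13 k14 k15 k16 k17 k18 k19 k20 k21 k22 k23 k24
    by argo
qed

text \<open>By the previous lemma the graph has just these six vertices, and then \<open>c\<close>,
  \<open>d\<close> and, in the complement, \<open>r\<close> cannot all be non-simplicial.\<close>

lemma C4_2K2_share_edge:
  assumes C4: "ind_C4 E p q r s" and K: "E c d" "\<not> E p c" "\<not> E p d" "\<not> E q c" "\<not> E q d"
  shows False
proof -
  have V: "v \<in> {p, q, r, s, c, d}" if "v \<in> V" for v
    using C4_2K2_share_edge_extra[OF assms that] by blast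
  have in_V: "c \<in> V" "d \<in> V" "r \<in> V"
    using C4 K(1) E_V by (auto simp: ind_C4_def)
  have C4': "E p q" "E q r" "E r s" "E s p" "E q p" "E r q" "E s r" "E p s" "\<not> E p r" "\<not> E r p"
    and K': "E d c" "\<not> E c p" "\<not> E d p" "\<not> E c q" "\<not> E d q"
    using C4 K E_sym unfolding ind_C4_def by blast+
  obtain u w where uw: "E c u" "E c w" "u \<noteq> w" "\<not> E u w"
    using nonsimplicial[OF in_V(1)] .
  then have "u \<in> {d, r, s}" "w \<in> {d, r, s}"
    using V E_V E_irrefl K' by blast+
  \<comment> \<open>As \<open>r\<close> and \<open>s\<close> are adjacent, two nonadjacent
    neighbours of \<open>c\<close> must be \<open>d\<close> and one of \<open>r\<close>,
    \<open>s\<close>.\<close>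
  then have cd: "E c r \<and> \<not> E d r \<or> E c s \<and> \<not> E d s"
    using uw C4' by (auto simp: E_commute)
  obtain u w where uw: "E d u" "E d w" "u \<noteq> w" "\<not> E u w"
    using nonsimplicial[OF in_V(2)] .
  then have "u \<in> {c, r, s}" "w \<in> {c, r, s}"
    using V E_V E_irrefl K' by blast+
  then have "E d r \<and> \<not> E c r \<or> E d s \<and> \<not> E c s"
    using uw C4' by (auto simp: E_commute)
  with cd have "E c r \<or> E d r"
    by blast
  \<comment> \<open>The only possible edge among the non-neighbours of \<open>r\<close> joins
    \<open>c\<close> and \<open>d\<close>.\<close>
  moreover obtain x y where xy: "x \<in> V" "y \<in> V" "x \<noteq> r" "y \<noteq> r" "\<not> E r x" "\<not> E r y" "E x y"
    using nonsimplicial_co[OF in_V(3)] .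
  then have "x \<in> {p, c, d}" "y \<in> {p, c, d}"
    using V C4' by blast+
  then have "\<not> E c r \<and> \<not> E d r"
    using xy K K' E_irrefl E_sym by (metis insertE singletonD)
  ultimately show False
    by blast
qed

lemma C4_2K2_not_first:
  assumes C4: "ind_C4 E p q r s" and K: "ind_2K2 E p b c d"
  shows False
proof -
  interpret co: bad_graph V "co V E"
    by (rule bad_co)
  have C4': "E p q" "E q r" "E r s" "E s p" "E q p" "E r q" "E s r" "E p s" "\<not> E p r" "\<not> E r p"
      "\<not> E q s" "\<not> E s q" "p \<noteq> r" "q \<noteq> s"
    and K': "E p b" "E b p" "E c d" "E d c" "\<not> E p c" "\<not> E p d" "\<not> E b c" "\<not> E b d"
      "\<not> E c p" "\<not> E d p" "\<not> E c b" "\<not> E d b"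
    using C4 K E_sym unfolding ind_C4_def ind_2K2_def by blast+
  have V: "p \<in> V" "q \<in> V" "r \<in> V" "s \<in> V" "b \<in> V" "c \<in> V" "d \<in> V"
    using C4' K' E_V by blast+
  \<comment> \<open>If \<open>p\<close> and \<open>r\<close> lie in different edges of the
    \<open>2K\<^sub>2\<close>, complementation swaps the two kinds of subgraph: they then share the
    edge between \<open>p\<close> and \<open>r\<close>.\<close>
  have nonedge: False if "ind_2K2 E p b r d" for d
  proof (rule co.C4_2K2_share_edge[of p r b d q s])
    have "d \<in> V" "d \<noteq> b" "d \<noteq> p" "r \<noteq> b" "r \<noteq> d" "p \<noteq> b" "\<not> E r b" "\<not> E d p"
      using that C4' K' E_V E_sym E_irrefl unfolding ind_2K2_def by blast+
    then show "ind_C4 (co V E) p r b d"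
      using that V C4' K' unfolding ind_C4_def ind_2K2_def co_def by blast
  qed (use V C4' in \<open>auto simp: co_def\<close>)
  have K2: "ind_2K2 E p b d c"
    using K' by (simp add: ind_2K2_def)
  have C4_rev: "ind_C4 E p s r q"
    using C4' by (simp add: ind_C4_def)
  consider "b = q" | "b = s" | "c = r" | "d = r" | "{b, c, d} \<inter> {q, r, s} = {}"
    using C4' K' by blast
  then show False
  proof cases
    case 1
    then show False
      using C4_2K2_share_edge[OF C4] K' by blast
  next
    case 2
    then show False
      using C4_2K2_share_edge[OF C4_rev] K' by blast
  next
    case 3
    then show False
      using nonedge K by blast
  next
    case 4
    then show False
      using nonedge K2 by blast
  next
    case 5
    then show False
      using C4_2K2_share_vertex[OF C4 K'(1,3,5-8)] by blast
  qed
qed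

text \<open>Serves below as an engine: any further induced 4-cycle or \<open>2K\<^sub>2\<close> that
  meets a given one of the other kind is a contradiction.\<close>

lemma C4_2K2_disjoint:
  assumes C4: "ind_C4 E p q r s" and K: "ind_2K2 E a b c d"
  shows "{p, q, r, s} \<inter> {a, b, c, d} = {}"
proof -
  have rot: "ind_C4 E q r s p" "ind_C4 E r s p q" "ind_C4 E s p q r"
    using C4 E_sym unfolding ind_C4_def by blast+
  have sw: "ind_2K2 E b a c d" "ind_2K2 E c d a b" "ind_2K2 E d c a b"
    using K E_sym unfolding ind_2K2_def by blast+
  have "x \<notin> {a, b, c, d}" if "ind_C4 E x y z w" for x y z w
    using C4_2K2_not_first[OF that] K sw by blast
  then show ?thesis
    using C4 rot by blast
qed

text \<open>First \<open>a\<close> is adjacent to the whole 4-cycle. Then \<open>q\<close> and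
  \<open>s\<close> each see exactly one of \<open>c\<close>, \<open>d\<close>, and not the same one;
  the one that sees \<open>d\<close> forms a 4-cycle with \<open>p\<close>, \<open>d\<close>,
  \<open>c\<close>.\<close>

lemma C4_2K2_crossing:
  assumes C4: "ind_C4 E p q r s" and K: "ind_2K2 E a b c d"
    and adj: "E p a" "E p c" "E r d" "\<not> E p d" "\<not> E r c"
  shows False
proof -
  note disj = C4_2K2_disjoint
  have dist: "{p, q, r, s} \<inter> {a, b, c, d} = {}"
    using disj[OF C4 K] .
  have C4': "E p q" "E q r" "E r s" "E s p" "E q p" "E r q" "E s r" "E p s" "\<not> E p r" "\<not> E r p"
      "\<not> E q s" "\<not> E s q" "p \<noteq> r" "q \<noteq> s"
    and K': "E a b" "E b a" "E c d" "E d c" "\<not> E a c" "\<not> E a d" "\<not> E b c" "\<not> E b d"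
      "\<not> E c a" "\<not> E d a" "\<not> E c b" "\<not> E d b"
    and adj': "E a p" "E c p" "E d r" "\<not> E d p" "\<not> E c r"
    using C4 K adj E_sym unfolding ind_C4_def ind_2K2_def by blast+
  have "E r a"
  proof (rule ccontr)
    assume "\<not> E r a"
    then have "ind_2K2 E p a r d"
      using adj K' C4' E_sym unfolding ind_2K2_def by blast
    then show False
      using disj[OF C4] by blast
  qed
  have "E q a"
  proof (rule ccontr)
    assume "\<not> E q a"
    then have "ind_C4 E p q r a"
      using C4' adj' \<open>E r a\<close> dist unfolding ind_C4_def by blast
    then show False
      using disj[OF _ K] by blast
  qed
  have "E s a"
  proof (rule ccontr)
    assume "\<not> E s a"
    then have "ind_C4 E p s r a"
      using C4' adj' \<open>E r a\<close> dist unfolding ind_C4_def by blast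
    then show False
      using disj[OF _ K] by blast
  qed
  have hit: "E q c \<or> E q d" "E s c \<or> E s d"
  proof -
    have "\<not> ind_2K2 E q a c d" "\<not> ind_2K2 E s a c d"
      using disj[OF C4] by blast+
    then show "E q c \<or> E q d" "E s c \<or> E s d"
      using \<open>E q a\<close> \<open>E s a\<close> K' unfolding ind_2K2_def by blast+
  qed
  have once: "\<not> (E q x \<and> E s x)" if "x \<in> {c, d}" for x
  proof
    assume "E q x \<and> E s x"
    then have "ind_C4 E q a s x"
      using \<open>E q a\<close> \<open>E s a\<close> C4' K' that E_sym unfolding ind_C4_def by blast
    then show False
      using disj[OF _ K] by blast
  qed
  have "\<not> ind_C4 E p s d c" "\<not> ind_C4 E p q d c"
    using disj[OF _ K] by blast+
  then have "\<not> (E s d \<and> \<not> E s c)" "\<not> (E q d \<and> \<not> E q c)"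
    using C4' K' adj adj' dist unfolding ind_C4_def by blast+
  then show False
    using hit once[of c] once[of d] by blast
qed

text \<open>Both \<open>p\<close> and \<open>r\<close> also see the edge between \<open>c\<close>
  and \<open>d\<close>. Common neighbours on both edges would give a 4-cycle, so on one edge they
  see different single ends, which \<open>C4_2K2_crossing\<close> excludes.\<close>

lemma C4_2K2_hit:
  assumes C4: "ind_C4 E p q r s" and K: "ind_2K2 E a b c d"
    and hit: "E p a \<or> E p b" "E r a \<or> E r b"
  shows False
proof -
  have Ks: "ind_2K2 E b a c d" "ind_2K2 E c d a b" "ind_2K2 E d c a b" "ind_2K2 E a b d c"
     "ind_2K2 E b a d c" "ind_2K2 E c d b a" "ind_2K2 E d c b a"
    using K E_sym unfolding ind_2K2_def by blast+
  have rot: "ind_C4 E r s p q"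
    using C4 unfolding ind_C4_def by (auto dest: E_sym)
  have hit': "E t c \<or> E t d" if "E t a \<or> E t b" "ind_C4 E t u v w" for t u v w
  proof (rule ccontr)
    assume "\<not> ?thesis"
    then have "ind_2K2 E t a c d \<or> ind_2K2 E t b c d"
      using K that(1) unfolding ind_2K2_def by blast
    then show False
      using C4_2K2_disjoint[OF that(2)] by blast
  qed
  have hit_cd: "E p c \<or> E p d" "E r c \<or> E r d"
    using hit'[OF hit(1) C4] hit'[OF hit(2) rot] .
  have once: "\<not> (E p x \<and> E r x \<and> E p y \<and> E r y)" if "x \<in> {a, b}" "y \<in> {c, d}" for x y
  proof
    assume "E p x \<and> E r x \<and> E p y \<and> E r y"
    then have "ind_C4 E p x r y"
      using that C4 K E_sym unfolding ind_C4_def ind_2K2_def by blast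
    then show False
      using C4_2K2_disjoint[OF _ K] that by blast
  qed
  note crossing = C4_2K2_crossing[OF C4]
  have "\<not> (E p c \<and> E r d \<and> \<not> E p d \<and> \<not> E r c)" "\<not> (E p d \<and> E r c \<and> \<not> E p c \<and> \<not> E r d)"
    using hit(1) crossing[OF K] crossing[OF Ks(1)] crossing[OF Ks(4)] crossing[OF Ks(5)] by blast+
  moreover have "\<not> (E p a \<and> E r b \<and> \<not> E p b \<and> \<not> E r a)" "\<not> (E p b \<and> E r a \<and> \<not> E p a \<and> \<not> E r b)"
    using hit_cd(1) crossing[OF Ks(2)] crossing[OF Ks(3)] crossing[OF Ks(6)] crossing[OF Ks(7)] by blast+
  ultimately show False
    using hit hit_cd once[of a c] once[of a d] once[of b c] once[of b d] by blast
qed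

text \<open>No edge of the 4-cycle forms a \<open>2K\<^sub>2\<close> with \<open>a\<close>,
  \<open>b\<close>. So the cycle vertices that see \<open>a\<close> or \<open>b\<close> cover all
  its edges and include two opposite ones.\<close>

lemma not_C4_and_2K2:
  assumes C4: "ind_C4 E p q r s" and K: "ind_2K2 E a b c d"
  shows False
proof -
  have rot: "ind_C4 E q r s p"
    using C4 unfolding ind_C4_def by (auto dest: E_sym)
  have "\<not> ind_2K2 E p q a b" "\<not> ind_2K2 E q r a b" "\<not> ind_2K2 E r s a b" "\<not> ind_2K2 E s p a b"
    using C4_2K2_disjoint[OF C4] by blast+
  then have "E p a \<or> E p b \<or> E q a \<or> E q b" "E q a \<or> E q b \<or> E r a \<or> E r b"
      "E r a \<or> E r b \<or> E s a \<or> E s b" "E s a \<or> E s b \<or> E p a \<or> E p b"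
    using C4 K unfolding ind_C4_def ind_2K2_def by blast+
  then show False
    using C4_2K2_hit[OF C4 K] C4_2K2_hit[OF rot K] by blast
qed

subsection \<open>Induced 5-cycles\<close>

lemma C5_few_nbrs:
  assumes C5: "ind_C5 E a b c d e" and v: "v \<in> V" "v \<notin> {a, b, c, d, e}"
  shows "\<not> (E v a \<and> E v b \<and> \<not> E v c \<and> \<not> E v d \<and> \<not> E v e)"
    and "\<not> (E v a \<and> \<not> E v b \<and> E v c \<and> \<not> E v d \<and> \<not> E v e)"
    and "\<not> (E v a \<and> \<not> E v b \<and> \<not> E v c \<and> \<not> E v d \<and> \<not> E v e)"
proof -
  have V: "a \<in> V" "b \<in> V" "c \<in> V" "d \<in> V" "e \<in> V"
    using C5 E_V unfolding ind_C5_def by blast+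
  have "a \<noteq> b" "a \<noteq> c" "a \<noteq> d" "a \<noteq> e" "b \<noteq> c" "b \<noteq> d" "b \<noteq> e" "c \<noteq> d" "c \<noteq> e" "d \<noteq> e"
    using C5 E_irrefl E_sym unfolding ind_C5_def by blast+
  note facts = C5[unfolded ind_C5_def] V v this
  show "\<not> (E v a \<and> E v b \<and> \<not> E v c \<and> \<not> E v d \<and> \<not> E v e)"
    using no_double_null[of v a b d c e c e b a] facts by (auto simp: E_commute E_irrefl)
  show "\<not> (E v a \<and> \<not> E v b \<and> E v c \<and> \<not> E v d \<and> \<not> E v e)"
    using no_double_null[of b a c v a c d e d e] facts by (auto simp: E_commute E_irrefl)
  show "\<not> (E v a \<and> \<not> E v b \<and> \<not> E v c \<and> \<not> E v d \<and> \<not> E v e)"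
  proof
    assume va: "E v a \<and> \<not> E v b \<and> \<not> E v c \<and> \<not> E v d \<and> \<not> E v e"
    obtain w where w: "E v w" "w \<noteq> a"
      using nonsimplicial[OF v(1)] by metis
    then have "w \<noteq> v" "w \<notin> {a, b, c, d, e}"
      using va E_irrefl by blast+
    \<comment> \<open>The first instance applies if \<open>w\<close> is not adjacent to
      \<open>c\<close>, the second if it is.\<close>
    then show False
      using no_double_null[of v a w b a c d e d e] no_double_null[of v w a c w d e b e a]
        facts va w by (auto simp: E_commute E_irrefl)
  qed
qed

lemma C5_rotate:
  assumes "ind_C5 E a b c d e"
  shows "ind_C5 E b c d e a" "ind_C5 E c d e a b" "ind_C5 E d e a b c" "ind_C5 E e a b c d"
  using assms E_sym unfolding ind_C5_def by blast+

text \<open>The pentagram of the 5-cycle.\<close>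

lemma C5_co:
  assumes "ind_C5 E a b c d e"
  shows "ind_C5 (co V E) a c e b d"
proof -
  have "a \<in> V" "b \<in> V" "c \<in> V" "d \<in> V" "e \<in> V"
    "a \<noteq> c" "c \<noteq> e" "e \<noteq> b" "b \<noteq> d" "d \<noteq> a" "\<not> E a c" "\<not> E c e" "\<not> E e b" "\<not> E b d" "\<not> E d a"
    "E a e" "E c b" "E e d" "E b a" "E d c"
    using assms E_V E_sym unfolding ind_C5_def by blast+
  then show ?thesis
    unfolding ind_C5_def co_def by simp
qed

text \<open>Under rotation, \<open>C5_few_nbrs\<close> excludes one or two neighbours on the cycle;
  in the complement it excludes three or four.\<close>

lemma C5_uniform:
  assumes C5: "ind_C5 E a b c d e" and v: "v \<in> V" "v \<notin> {a, b, c, d, e}"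
  shows "E v a \<and> E v b \<and> E v c \<and> E v d \<and> E v e \<or>
    \<not> E v a \<and> \<not> E v b \<and> \<not> E v c \<and> \<not> E v d \<and> \<not> E v e"
proof -
  interpret co: bad_graph V "co V E"
    by (rule bad_co)
  have co_v: "co V E v x \<longleftrightarrow> \<not> E v x" if "x \<in> {a, b, c, d, e}" for x
    using that C5 v E_V unfolding co_def ind_C5_def by blast
  note co = C5_co[OF C5]
  have co_a: "co V E v a \<longleftrightarrow> \<not> E v a" and co_b: "co V E v b \<longleftrightarrow> \<not> E v b"
    and co_c: "co V E v c \<longleftrightarrow> \<not> E v c" and co_d: "co V E v d \<longleftrightarrow> \<not> E v d"
    and co_e: "co V E v e \<longleftrightarrow> \<not> E v e"
    using co_v by blast+
  have v': "v \<notin> {b, c, d, e, a}" "v \<notin> {c, d, e, a, b}" "v \<notin> {d, e, a, b, c}" "v \<notin> {e, a, b, c, d}"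
    "v \<notin> {a, c, e, b, d}" "v \<notin> {c, e, b, d, a}" "v \<notin> {e, b, d, a, c}" "v \<notin> {b, d, a, c, e}"
    "v \<notin> {d, a, c, e, b}"
    using v(2) by blast+
  note few = C5_few_nbrs[OF C5 v] C5_few_nbrs[OF C5_rotate(1)[OF C5] v(1) v'(1)]
    C5_few_nbrs[OF C5_rotate(2)[OF C5] v(1) v'(2)] C5_few_nbrs[OF C5_rotate(3)[OF C5] v(1) v'(3)]
    C5_few_nbrs[OF C5_rotate(4)[OF C5] v(1) v'(4)]
  note few_co = co.C5_few_nbrs[OF co v(1) v'(5)] co.C5_few_nbrs[OF co.C5_rotate(1)[OF co] v(1) v'(6)]
    co.C5_few_nbrs[OF co.C5_rotate(2)[OF co] v(1) v'(7)]
    co.C5_few_nbrs[OF co.C5_rotate(3)[OF co] v(1) v'(8)]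
    co.C5_few_nbrs[OF co.C5_rotate(4)[OF co] v(1) v'(9)]
  show ?thesis
    using few few_co[unfolded co_a co_b co_c co_d co_e] by argo
qed

lemma C5_dominated:
  assumes C5: "ind_C5 E a b c d e" and v: "v \<in> V" "v \<notin> {a, b, c, d, e}"
  shows "E v a"
proof (rule ccontr)
  assume "\<not> E v a"
  then have nv: "\<not> E v a" "\<not> E v b" "\<not> E v c" "\<not> E v d" "\<not> E v e"
    using C5_uniform[OF assms] by blast+
  have V: "a \<in> V" "b \<in> V" "c \<in> V" "d \<in> V" "e \<in> V"
    using C5 E_V unfolding ind_C5_def by blast+
  have dist: "a \<noteq> b" "a \<noteq> c" "a \<noteq> d" "a \<noteq> e" "b \<noteq> c" "b \<noteq> d" "b \<noteq> e" "c \<noteq> d" "c \<noteq> e" "d \<noteq> e"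
    using C5 E_irrefl E_sym unfolding ind_C5_def by blast+
  obtain u w where uw: "E v u" "E v w" "u \<noteq> w" "\<not> E u w"
    using nonsimplicial[OF v(1)] .
  then have out: "u \<in> V" "w \<in> V" "u \<notin> {a, b, c, d, e, v}" "w \<notin> {a, b, c, d, e, v}"
    using nv E_V E_irrefl by blast+
  have u: "E u a \<and> E u b \<and> E u c \<and> E u d \<and> E u e \<or>
      \<not> E u a \<and> \<not> E u b \<and> \<not> E u c \<and> \<not> E u d \<and> \<not> E u e"
    using C5_uniform[OF C5] out by blast
  have w: "E w a \<and> E w b \<and> E w c \<and> E w d \<and> E w e \<or>
      \<not> E w a \<and> \<not> E w b \<and> \<not> E w c \<and> \<not> E w d \<and> \<not> E w e"
    using C5_uniform[OF C5] out by blast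
  note facts = C5[unfolded ind_C5_def] V v dist nv uw out
  \<comment> \<open>In all four cases \<open>a\<close> and \<open>v\<close> get colour 0 in both
    graphs, and \<open>c\<close>, \<open>d\<close> are the seeds in the complement.\<close>
  consider "E u a" "E w a" | "E u a" "\<not> E w a" "\<not> E w b" | "\<not> E u a" "\<not> E u b" "E w a"
    | "\<not> E u b" "\<not> E w e"
    using u w by blast
  then show False
  proof cases
    case 1
    then show False
      using no_double_null[of a u w v u w c d c d] facts by (auto simp: E_commute E_irrefl)
  next
    case 2
    then show False
      using no_double_null[of a u b v u w c d c d] facts by (auto simp: E_commute E_irrefl)
  next
    case 3
    then show False
      using no_double_null[of a w b v w u c d c d] facts by (auto simp: E_commute E_irrefl)
  next
    case 4
    then show False
      using no_double_null[of a b e v u w c d c d] facts by (auto simp: E_commute E_irrefl)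
  qed
qed

text \<open>By \<open>C5_dominated\<close> in both graphs, a vertex off the cycle would be adjacent
  to \<open>a\<close> in the graph and in its complement.\<close>

lemma C5_spanning:
  assumes C5: "ind_C5 E a b c d e"
  shows "V = {a, b, c, d, e}"
proof -
  interpret co: bad_graph V "co V E"
    by (rule bad_co)
  have "v \<in> {a, b, c, d, e}" if "v \<in> V" for v
  proof (rule ccontr)
    assume out: "v \<notin> {a, b, c, d, e}"
    then have "co V E v a"
      using co.C5_dominated[OF C5_co[OF C5], of v] that by blast
    then show False
      using C5_dominated[OF C5 that out] by (simp add: co_def)
  qed
  moreover have "{a, b, c, d, e} \<subseteq> V"
    using C5 E_V unfolding ind_C5_def by blast
  ultimately show ?thesis
    by blast
qed

lemma bad_is_C5:
  assumes "V \<noteq> {}"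
  obtains a b c d e where "ind_C5 E a b c d e" "V = {a, b, c, d, e}"
proof -
  interpret co: bad_graph V "co V E"
    by (rule bad_co)
  have "\<exists>a b c d e. ind_C5 E a b c d e"
  proof (rule ccontr)
    assume no: "\<not> ?thesis"
    then have "\<not> ind_C5 (co V E) a b c d e" for a b c d e
      using co.C5_co[of a b c d e] co_co by auto
    then obtain p q r s where "ind_C4 (co V E) p q r s"
      using co.C4_or_C5[OF assms] by blast
    then have "ind_2K2 E p r q s"
      unfolding ind_C4_def ind_2K2_def co_def using E_sym by blast
    moreover obtain p' q' r' s' where "ind_C4 E p' q' r' s'"
      using C4_or_C5[OF assms] no by blast
    ultimately show False
      using not_C4_and_2K2 by blast
  qed
  then show thesis
    using C5_spanning that by blast
qed

end

section \<open>The bound\<close>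

lemma gamma_ri_le_rainbow:
  assumes "rainbow_pair (pverts G) (\<lambda>u v. (u, v) \<in> parcs G) I J"
  shows "gamma_ri 2 G \<le> card (I \<union> J)"
proof -
  define f where "f v = (if v \<in> I then 1 else if v \<in> J then 2 else 0 :: nat)" for v
  note R = assms[unfolded rainbow_pair_def]
  have one: "{v \<in> pverts G. f v = 1} = I" and two: "{v \<in> pverts G. f v = 2} = J"
    and nz: "{v \<in> pverts G. f v \<noteq> 0} = I \<union> J"
    using R by (auto simp: f_def)
  have "independent_set G I" "independent_set G J"
    using R by (auto simp: independent_set_def)
  moreover have "(\<exists>u\<in>pverts G. (v, u) \<in> parcs G \<and> f u = 1) \<and> (\<exists>u\<in>pverts G. (v, u) \<in> parcs G \<and> f u = 2)"
    if "v \<in> pverts G" "f v = 0" for v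
  proof -
    have "v \<in> pverts G - (I \<union> J)"
      using that by (auto simp: f_def split: if_splits)
    then obtain u w where "u \<in> I" "(v, u) \<in> parcs G" "w \<in> J" "(v, w) \<in> parcs G"
      using R by blast
    then show ?thesis
      using one two by blast
  qed
  moreover have "{1..2} = {1, 2 :: nat}"
    by auto
  ultimately have "kRiDF 2 G f"
    using one two by (auto simp: kRiDF_def f_def)
  moreover have "weight G f = card (I \<union> J)"
    unfolding weight_def nz ..
  ultimately show ?thesis
    unfolding gamma_ri_def by (intro Least_le) blast
qed

section \<open>Isomorphism with the 5-cycle\<close>

lemma cycle_graph_5:
  "pverts (cycle_graph 5) = {0, 1, 2, 3, 4}"
  "parcs (cycle_graph 5) = {(0, 1), (1, 2), (2, 3), (3, 4), (4, 0), (1, 0), (2, 1), (3, 2), (4, 3), (0, 4)}"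
proof -
  show "pverts (cycle_graph 5) = {0, 1, 2, 3, 4}"
    by (auto simp: cycle_graph_def)
  show "parcs (cycle_graph 5) =
      {(0, 1), (1, 2), (2, 3), (3, 4), (4, 0), (1, 0), (2, 1), (3, 2), (4, 3), (0, 4)}"
    (is "_ = ?R")
  proof
    have five: "(i, (i + 1) mod 5) \<in> ?R" "((i + 1) mod 5, i) \<in> ?R" if "i < 5" for i :: nat
    proof -
      have "i = 0 \<or> i = 1 \<or> i = 2 \<or> i = 3 \<or> i = 4"
        using that by linarith
      then show "(i, (i + 1) mod 5) \<in> ?R" "((i + 1) mod 5, i) \<in> ?R"
        by (elim disjE; simp)+
    qed
    show "parcs (cycle_graph 5) \<subseteq> ?R"
    proof
      fix x assume "x \<in> parcs (cycle_graph 5)"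
      then obtain i j where ij: "x = (i, j)" "i < 5" "j < 5" "j = (i + 1) mod 5 \<or> i = (j + 1) mod 5"
        unfolding cycle_graph_def by (simp only: pair_pre_digraph.simps) blast
      from ij(4) show "x \<in> ?R"
      proof
        assume "j = (i + 1) mod 5"
        then show "x \<in> ?R"
          using five(1)[OF ij(2)] ij(1) by (simp only:)
      next
        assume "i = (j + 1) mod 5"
        then show "x \<in> ?R"
          using five(2)[OF ij(3)] ij(1) by (simp only:)
      qed
    qed
    show "?R \<subseteq> parcs (cycle_graph 5)"
      by (simp add: cycle_graph_def)
  qed
qed

lemma digraph_iso_cycle_graph_5:
  assumes "pair_graph G" and C5: "ind_C5 (\<lambda>u v. (u, v) \<in> parcs G) a b c d e"
    and V: "pverts G = {a, b, c, d, e}"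
  shows "digraph_iso (with_proj G) (with_proj (cycle_graph 5))"
proof -
  interpret pair_graph G
    by fact
  have sym: "(u, v) \<in> parcs G \<Longrightarrow> (v, u) \<in> parcs G" for u v
    using arcs_symmetric by simp
  have irrefl: "(u, u) \<notin> parcs G" for u
    using pair_no_loops by fastforce
  have adj: "(a, b) \<in> parcs G" "(b, c) \<in> parcs G" "(c, d) \<in> parcs G" "(d, e) \<in> parcs G" "(e, a) \<in> parcs G"
      "(b, a) \<in> parcs G" "(c, b) \<in> parcs G" "(d, c) \<in> parcs G" "(e, d) \<in> parcs G" "(a, e) \<in> parcs G"
    and nadj: "(a, c) \<notin> parcs G" "(b, d) \<notin> parcs G" "(c, e) \<notin> parcs G" "(d, a) \<notin> parcs G" "(e, b) \<notin> parcs G"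
      "(c, a) \<notin> parcs G" "(d, b) \<notin> parcs G" "(e, c) \<notin> parcs G" "(a, d) \<notin> parcs G" "(b, e) \<notin> parcs G"
    using C5 sym unfolding ind_C5_def by blast+
  have dist: "a \<noteq> b" "a \<noteq> c" "a \<noteq> d" "a \<noteq> e" "b \<noteq> c" "b \<noteq> d" "b \<noteq> e" "c \<noteq> d" "c \<noteq> e" "d \<noteq> e"
    using adj nadj irrefl by metis+
  have arcs: "parcs G = {(a, b), (b, c), (c, d), (d, e), (e, a), (b, a), (c, b), (d, c), (e, d), (a, e)}"
    (is "_ = ?R")
  proof
    show "parcs G \<subseteq> ?R"
    proof
      fix x assume x: "x \<in> parcs G"
      obtain u v where uv: "x = (u, v)"
        by (cases x)
      then have "u \<in> {a, b, c, d, e}" "v \<in> {a, b, c, d, e}"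
        using x V wellformed' by blast+
      then show "x \<in> ?R"
        using x uv nadj irrefl by auto
    qed
    show "?R \<subseteq> parcs G"
      using adj by blast
  qed
  \<comment> \<open>The default value 4 is the image of \<open>e\<close>.\<close>
  define h where "h v = (if v = a then 0 else if v = b then 1 else if v = c then 2
    else if v = d then 3 else 4 :: nat)" for v
  have h: "h a = 0" "h b = 1" "h c = 2" "h d = 3" "h e = 4"
    using dist by (auto simp: h_def)
  have inj: "inj_on h (pverts G)"
    unfolding V using h by (auto simp: inj_on_def)
  define f where "f = \<lparr>iso_verts = h, iso_arcs = map_prod h h, iso_head = snd, iso_tail = fst\<rparr>"
  have "inj_on (map_prod h h) (parcs G)"
    using inj wellformed' by (auto simp: inj_on_def)
  then have "pre_digraph.digraph_isomorphism (with_proj G) f"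
    unfolding pre_digraph.digraph_isomorphism_def using inj wf_digraph_axioms
    by (simp add: f_def with_proj_def)
  moreover have "with_proj (cycle_graph 5) = app_iso f (with_proj G)"
    unfolding app_iso_def with_proj_def using h
    by (simp add: f_def cycle_graph_5 V arcs)
  ultimately show ?thesis
    unfolding digraph_iso_def by blast
qed

theorem theorem9:
  fixes G :: "'a pair_pre_digraph" and n :: nat
  assumes "pair_graph G"
    and "card (pverts G) = n"
    and "n \<ge> 2"
    and "\<not> digraph_iso (with_proj G) (with_proj (cycle_graph 5))"
  shows "gamma_ri 2 G + gamma_ri 2 (graph_complement G) \<le> n + 2"
proof -
  interpret pair_graph G
    by fact
  let ?V = "pverts G" and ?E = "\<lambda>u v. (u, v) \<in> parcs G"
  interpret sgraph ?V ?E
  proof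
    show "finite ?V"
      by (rule pair_finite_verts)
    show "(v, u) \<in> parcs G" if "(u, v) \<in> parcs G" for u v
      using that arcs_symmetric by simp
    show "(u, u) \<notin> parcs G" for u
      using pair_no_loops by fastforce
    show "u \<in> ?V \<and> v \<in> ?V" if "(u, v) \<in> parcs G" for u v
      using that wellformed' by blast
  qed
  have "good ?V ?E"
  proof (rule ccontr)
    assume "\<not> good ?V ?E"
    then interpret bad_graph ?V ?E
      by unfold_locales
    have "?V \<noteq> {}"
      using assms(2,3) by auto
    then show False
      using bad_is_C5 digraph_iso_cycle_graph_5[OF assms(1)] assms(4) by metis
  qed
  then obtain I J A B where IJ: "rainbow_pair ?V ?E I J" and AB: "rainbow_pair ?V (co ?V ?E) A B"
    and le: "card (I \<union> J) + card (A \<union> B) \<le> card ?V + 2"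
    unfolding good_def by blast
  have "gamma_ri 2 G \<le> card (I \<union> J)"
    using gamma_ri_le_rainbow[OF IJ] .
  moreover have "(\<lambda>u v. (u, v) \<in> parcs (graph_complement G)) = co ?V ?E"
    by (auto simp: graph_complement_def co_def fun_eq_iff)
  then have "gamma_ri 2 (graph_complement G) \<le> card (A \<union> B)"
    using AB by (intro gamma_ri_le_rainbow) (simp add: graph_complement_def)
  ultimately show ?thesis
    using le assms(2) by linarith
qed

end
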